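(* Let $T$ be a Leibniz triple system (of arbitrary dimension, over an arbitrary field $\mathbb{F}$) admitting a $\mu$-multiplicative basis $\mathcal{B}=\{e_n\}_{n\in I}\,\dot\cup\,\{u_r\}_{r\in J}$. Then $T$ is minimal if and only if the index sets $I$ and $J$ have all of their elements connected, respectively (i.e. any two elements of $I$ are connected, and any two elements of $J$ are connected).
   Context: A Leibniz triple system over a field $\mathbb{F}$ is an $\mathbb{F}$-vector space $T$ with a trilinear product $\{\cdot,\cdot,\cdot\}:T\times T\times T\to T$ such that for all $a,b,c,d,f\in T$: $\{a,\{b,c,d\},f\}=\{\{a,b,c\},d,f\}-\{\{a,c,b\},d,f\}-\{\{a,d,b\},c,f\}+\{\{a,d,c\},b,f\}$ and $\{a,b,\{c,d,f\}\}=\{\{a,b,c\},d,f\}-\{\{a,b,d\},c,f\}-\{\{a,b,f\},c,d\}+\{\{a,b,f\},d,c\}$. A subtriple is a linear subspace $S$ with $\{S,S,S\}\subset S$. An ideal is a linear subspace $\mathcal I$ with $\{\mathcal I,T,T\}+\{T,\mathcal I,T\}+\{T,T,\mathcal I\}\subset\mathcal I$. $\mathfrak I$ denotes the ideal of $T$ generated by $\{\{x,y,z\}-\{x,z,y\}+\{y,z,x\}:x,y,z\in T\}$, and $T=\mathfrak I\oplus\neg\mathfrak I$ with $\neg\mathfrak I$ a linear complement. A basis $\{v_k\}_{k\in K}$ is multiplicative if for all $k_1,k_2,k_3\in K$ either $\{v_{k_1},v_{k_2},v_{k_3}\}=0$ or $0\neq\{v_{k_1},v_{k_2},v_{k_3}\}\in\mathbb{F}v_k$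 for some $k\in K$. The multiplicative basis considered is $\mathcal{B}=\mathcal{B}_{\mathfrak I}\dot\cup\mathcal{B}_{\neg\mathfrak I}$ with $\mathcal{B}_{\mathfrak I}=\{e_n\}_{n\in I}$ a basis of $\mathfrak I$, $\mathcal{B}_{\neg\mathfrak I}=\{u_r\}_{r\in J}$ a basis of $\neg\mathfrak I$, and $I\cap J=\emptyset$. A subtriple $S$ admits a multiplicative basis $\mathcal{B}_S$ inherited from $\mathcal{B}$ if $\mathcal{B}_S$ is a multiplicative basis of $S$ and $\mathcal{B}_S\subset\mathcal{B}$. For each $k\in I\dot\cup J$ introduce a new symbol $\overline k\notin I\dot\cup J$; $\overline I=\{\overline n:n\in I\}$, $\overline J=\{\overline r:r\in J\}$, and $\overline{(\overline k)}:=k$. $\mathcal{P}(A)$ is the power set of $A$; $S_n$ is the group of permutations of $n$ elements. Map $a:(I\dot\cup J)^3\to\mathcal{P}(I\dot\cup J)$: for $n\in I$, $r_1,r_2\in J$, $a(n,r_1,r_2)=\{m\}$ if $0\ne\{e_n,u_{r_1},u_{r_2}\}\in\mathbb{F}e_m$ with $m\in I$; for $r_1,r_2,r_3\in J$, $a(r_1,r_2,r_3)=\{n\}$ if $0\neq\{u_{r_1},u_{r_2},u_{r_3}\}\in\mathbb{F}e_n$ with $n\in I$, and $=\{s\}$ if $0\neq\{u_{r_1},u_{r_2},u_{r_3}\}\in\mathbb{F}u_s$ with $s\in J$; and $a=\emptyset$ in all remaining cases. Map $b:(I\dot\cup J)\times(\overline I\dot\cup\overline J)^2\to\mathcal{P}(I\dot\cup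 J)$: for $n\in I$, $\overline r_1,\overline r_2\in\overline J$, $b(n,\overline r_1,\overline r_2)=\{m\in I:0\ne\{e_m,u_{r_1},u_{r_2}\}\in\mathbb{F}e_n\}\cup\{s\in J:0\neq\{u_s,u_{r_1},u_{r_2}\}\in\mathbb{F}e_n\}\cup\{s\in J:0\neq\{u_{r_1},u_s,u_{r_2}\}\in\mathbb{F}e_n\}\cup\{s\in J:0\neq\{u_{r_1},u_{r_2},u_s\}\in\mathbb{F}e_n\}$; for $r\in J$, $\overline r_1,\overline r_2\in\overline J$, $b(r,\overline r_1,\overline r_2)=\{s\in J:0\neq\{u_s,u_{r_1},u_{r_2}\}\in\mathbb{F}u_r\}\cup\{s\in J:0\neq\{u_{r_1},u_s,u_{r_2}\}\in\mathbb{F}u_r\}\cup\{s\in J:0\neq\{u_{r_1},u_{r_2},u_s\}\in\mathbb{F}u_r\}$; and $b=\emptyset$ in all remaining cases. Map $\mu:(I\dot\cup J)\times(I\dot\cup J\dot\cup\overline I\dot\cup\overline J)^2\to\mathcal{P}(I\dot\cup J)$: $\mu(k_1,k_2,k_3)=\bigcup_{\sigma\in S_3}a(k_{\sigma(1)},k_{\sigma(2)},k_{\sigma(3)})$ for $k_1,k_2,k_3\in I\dot\cup J$; $\mu(k,\overline k_1,\overline k_2)=\bigcup_{\sigma\in S_2}b(k,\overline k_{\sigma(1)},\overline k_{\sigma(2)})$ for $k\in I\dot\cup J$, $\overline k_1,\overline k_2\in\overline J$; and $\mu=\emptyset$ in all remaining cases. Map $\phi$: for $K\subset I\dot\cup J$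 and $p,q\in I\dot\cup J\dot\cup\overline I\dot\cup\overline J$, $\phi(K,p,q)=\bigcup_{k\in K}\mu(k,p,q)$. For $k,k'\in I\dot\cup J$, $k$ is connected to $k'$ if either $k=k'$ or there is a (finite, ordered) collection $\{k_1,k_2,\dots,k_{2n+1}\}\subset I\dot\cup J\dot\cup\overline I\dot\cup\overline J$, $n\ge1$, called a connection from $k$ to $k'$, such that: $k_1=k$; the sets $\phi(\{k_1\},k_2,k_3)$, $\phi(\phi(\{k_1\},k_2,k_3),k_4,k_5)$, ..., $\phi(\phi(\cdots\phi(\{k_1\},k_2,k_3)\cdots),k_{2n-2},k_{2n-1})$ are all nonempty; and $k'\in\phi(\phi(\cdots\phi(\{k_1\},k_2,k_3)\cdots),k_{2n},k_{2n+1})$. The basis $\mathcal{B}$ is $\mu$-multiplicative if it is multiplicative and, whenever $t_1,t_2\in I\dot\cup J$ and $s_1,s_2\in J$ (resp. $s_1,s_2\in\overline J$) satisfy $t_2\in\mu(t_1,s_1,s_2)$, one has $v_{t_2}\in\mathbb{F}\{v_{t_1},u_{s_{\sigma(1)}},u_{s_{\sigma(2)}}\}$ (resp. $v_{t_2}\in\mathbb{F}\{v_{t_1},u_{\overline{s}_{\sigma(1)}},u_{\overline{s}_{\sigma(2)}}\}$) for some $\sigma\in S_2$, where $v_{t_i}=e_{t_i}$ if $t_i\in I$ and $v_{t_i}=u_{t_i}$ if $t_i\in J$. A Leibniz triple system $T$ admitting a multiplicative basis $\mathcal{B}$ is minimal if its only nonzero ideals admitting a multiplicative basis inherited from $\mathcal{B}$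 are $\mathfrak I$ or $T$. *)

theory Defs
  imports Complex_Main "HOL-Combinatorics.Permutations"
begin

locale leibniz_triple_system = vector_space scale
  for scale :: "'f::field \<Rightarrow> 'v::ab_group_add \<Rightarrow> 'v" +
  fixes tri :: "'v \<Rightarrow> 'v \<Rightarrow> 'v \<Rightarrow> 'v"
  assumes linear1: "Vector_Spaces.linear scale scale (\<lambda>x. tri x y z)"
    and linear2: "Vector_Spaces.linear scale scale (\<lambda>y. tri x y z)"
    and linear3: "Vector_Spaces.linear scale scale (\<lambda>z. tri x y z)"
    and leibniz_mid:
      "tri a (tri b c d) f =
         tri (tri a b c) d f - tri (tri a c b) d f - tri (tri a d b) c f + tri (tri a d c) b f"
    and leibniz_right:
      "tri a b (tri c d f) =
         tri (tri a b c) d f - tri (tri a b d) c f - tri (tri a b f) c d + tri (tri a b f) d c"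
begin

definition subtriple :: "'v set \<Rightarrow> bool" where
  "subtriple S \<longleftrightarrow> subspace S \<and> (\<forall>x\<in>S. \<forall>y\<in>S. \<forall>z\<in>S. tri x y z \<in> S)"

definition ideal :: "'v set \<Rightarrow> bool" where
  "ideal S \<longleftrightarrow> subspace S \<and> (\<forall>x\<in>S. \<forall>y z. tri x y z \<in> S \<and> tri y x z \<in> S \<and> tri y z x \<in> S)"

definition ideal_generated :: "'v set \<Rightarrow> 'v set" where
  "ideal_generated G = \<Inter>{S. ideal S \<and> G \<subseteq> S}"

definition frakI :: "'v set" where
  "frakI = ideal_generated {tri x y z - tri x z y + tri y z x | x y z. True}"

definition nonzero_in_line :: "'v \<Rightarrow> 'v \<Rightarrow> bool" where
  "nonzero_in_line x w \<longleftrightarrow> x \<noteq> 0 \<and> x \<in> span {w}"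

definition basis_of :: "'v set \<Rightarrow> 'v set \<Rightarrow> bool" where
  "basis_of S B \<longleftrightarrow> independent B \<and> span B = S"

definition multiplicative_basis :: "'v set \<Rightarrow> 'v set \<Rightarrow> bool" where
  "multiplicative_basis S B \<longleftrightarrow> basis_of S B \<and>
     (\<forall>x\<in>B. \<forall>y\<in>B. \<forall>z\<in>B. tri x y z = 0 \<or> (\<exists>w\<in>B. nonzero_in_line (tri x y z) w))"

definition admits_inherited_basis :: "'v set \<Rightarrow> 'v set \<Rightarrow> bool" where
  "admits_inherited_basis B S \<longleftrightarrow> subtriple S \<and> (\<exists>B'. B' \<subseteq> B \<and> multiplicative_basis S B')"

definition minimal :: "'v set \<Rightarrow> bool" where
  "minimal B \<longleftrightarrow>
     (\<forall>S. ideal S \<and> S \<noteq> {0} \<and> admits_inherited_basis B S \<longrightarrow> S = frakI \<or> S = UNIV)"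

end

(* A symbol over the index type: Plain k is the index k itself, Bar k is the new symbol
   written as k with an overline. *)
datatype 'k symb = Plain 'k | Bar 'k

(* The complement negI is part of the data; the families e and u are only relevant on
   I and J, respectively. *)
locale leibniz_triple_split_basis = leibniz_triple_system scale tri
  for scale :: "'f::field \<Rightarrow> 'v::ab_group_add \<Rightarrow> 'v"
    and tri :: "'v \<Rightarrow> 'v \<Rightarrow> 'v \<Rightarrow> 'v" +
  fixes negI :: "'v set" and I J :: "'k set" and e u :: "'k \<Rightarrow> 'v"
  assumes negI_subspace: "subspace negI"
    and frakI_plus_negI: "{x + y | x y. x \<in> frakI \<and> y \<in> negI} = UNIV"
    and frakI_Int_negI: "frakI \<inter> negI = {0}"
    and IJ_disjoint: "I \<inter> J = {}"
    and e_inj: "inj_on e I" and e_basis: "basis_of frakI (e ` I)"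
    and u_inj: "inj_on u J" and u_basis: "basis_of negI (u ` J)"
begin

definition v :: "'k \<Rightarrow> 'v" where
  "v k = (if k \<in> I then e k else u k)"

definition B :: "'v set" where
  "B = e ` I \<union> u ` J"

definition symbols :: "'k symb set" where
  "symbols = Plain ` (I \<union> J) \<union> Bar ` (I \<union> J)"

(* As the basis vectors are linearly independent, each of these sets has at most one element. *)
definition a :: "'k \<Rightarrow> 'k \<Rightarrow> 'k \<Rightarrow> 'k set" where
  "a k1 k2 k3 =
    (if k1 \<in> I \<and> k2 \<in> J \<and> k3 \<in> J then
       {m \<in> I. nonzero_in_line (tri (e k1) (u k2) (u k3)) (e m)}
     else if k1 \<in> J \<and> k2 \<in> J \<and> k3 \<in> J then
       {n \<in> I. nonzero_in_line (tri (u k1) (u k2) (u k3)) (e n)} \<union>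
       {s \<in> J. nonzero_in_line (tri (u k1) (u k2) (u k3)) (u s)}
     else {})"

(* The second and third arguments of the map b are always barred symbols, so b k r1 r2
   takes the indices below the bars. *)
definition b :: "'k \<Rightarrow> 'k \<Rightarrow> 'k \<Rightarrow> 'k set" where
  "b k r1 r2 =
    (if k \<in> I \<and> r1 \<in> J \<and> r2 \<in> J then
       {m \<in> I. nonzero_in_line (tri (e m) (u r1) (u r2)) (e k)} \<union>
       {s \<in> J. nonzero_in_line (tri (u s) (u r1) (u r2)) (e k)} \<union>
       {s \<in> J. nonzero_in_line (tri (u r1) (u s) (u r2)) (e k)} \<union>
       {s \<in> J. nonzero_in_line (tri (u r1) (u r2) (u s)) (e k)}
     else if k \<in> J \<and> r1 \<in> J \<and> r2 \<in> J then
       {s \<in> J. nonzero_in_line (tri (u s) (u r1) (u r2)) (u k)} \<union>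
       {s \<in> J. nonzero_in_line (tri (u r1) (u s) (u r2)) (u k)} \<union>
       {s \<in> J. nonzero_in_line (tri (u r1) (u r2) (u s)) (u k)}
     else {})"

(* Outside the intended domain mu is empty because a and b are; permutations act on
   0-based positions. *)
fun mu :: "'k \<Rightarrow> 'k symb \<Rightarrow> 'k symb \<Rightarrow> 'k set" where
  "mu k (Plain p) (Plain q) =
     (\<Union>\<sigma>\<in>{\<sigma>. \<sigma> permutes {..<3::nat}}. a ([k, p, q] ! \<sigma> 0) ([k, p, q] ! \<sigma> 1) ([k, p, q] ! \<sigma> 2))"
| "mu k (Bar p) (Bar q) =
     (\<Union>\<sigma>\<in>{\<sigma>. \<sigma> permutes {..<2::nat}}. b k ([p, q] ! \<sigma> 0) ([p, q] ! \<sigma> 1))"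
| "mu k (Plain p) (Bar q) = {}"
| "mu k (Bar p) (Plain q) = {}"

definition phi :: "'k set \<Rightarrow> 'k symb \<Rightarrow> 'k symb \<Rightarrow> 'k set" where
  "phi K p q = (\<Union>k\<in>K. mu k p q)"

(* With ks = [k_1, ..., k_(2n+1)], where ks ! i is k_(i+1), this is the i-fold nested
   phi(...phi(phi({k}, k_2, k_3), k_4, k_5)..., k_(2i), k_(2i+1)). *)
primrec phi_iter :: "'k \<Rightarrow> 'k symb list \<Rightarrow> nat \<Rightarrow> 'k set" where
  "phi_iter k ks 0 = {k}"
| "phi_iter k ks (Suc i) = phi (phi_iter k ks i) (ks ! (2 * i + 1)) (ks ! (2 * i + 2))"

definition connection :: "'k \<Rightarrow> 'k \<Rightarrow> 'k symb list \<Rightarrow> bool" where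
  "connection k k' ks \<longleftrightarrow> set ks \<subseteq> symbols \<and>
     (\<exists>n\<ge>1. length ks = 2 * n + 1 \<and> ks ! 0 = Plain k \<and>
        (\<forall>i\<in>{1..<n}. phi_iter k ks i \<noteq> {}) \<and> k' \<in> phi_iter k ks n)"

definition connected_to :: "'k \<Rightarrow> 'k \<Rightarrow> bool" where
  "connected_to k k' \<longleftrightarrow> k \<in> I \<union> J \<and> k' \<in> I \<union> J \<and> (k = k' \<or> (\<exists>ks. connection k k' ks))"

(* The second condition is the case s_i = Plain r_i, the third one the case s_i = Bar r_i
   (so that r_i is the bar of s_i), with r_1, r_2 in J. *)
definition mu_multiplicative :: bool where
  "mu_multiplicative \<longleftrightarrow> multiplicative_basis UNIV B \<and>
     (\<forall>t1\<in>I \<union> J. \<forall>t2\<in>I \<union> J. \<forall>r1\<in>J. \<forall>r2\<in>J. t2 \<in> mu t1 (Plain r1) (Plain r2) \<longrightarrow>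
        (\<exists>\<sigma>. \<sigma> permutes {..<2::nat} \<and>
           v t2 \<in> span {tri (v t1) (u ([r1, r2] ! \<sigma> 0)) (u ([r1, r2] ! \<sigma> 1))})) \<and>
     (\<forall>t1\<in>I \<union> J. \<forall>t2\<in>I \<union> J. \<forall>r1\<in>J. \<forall>r2\<in>J. t2 \<in> mu t1 (Bar r1) (Bar r2) \<longrightarrow>
        (\<exists>\<sigma>. \<sigma> permutes {..<2::nat} \<and>
           v t2 \<in> span {tri (v t1) (u ([r1, r2] ! \<sigma> 0)) (u ([r1, r2] ! \<sigma> 1))}))"

end

end

theory Submission
  imports Defs
begin

text \<open>
  The proof matches ideals spanned by basis vectors with sets of indices closed under \<open>mu\<close>.

  The Leibniz identities force \<open>frakI\<close> to annihilate \<open>T\<close> from the second and the third slot of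
  the product (\<open>tri_frakI_right_slots\<close>). Hence a product of three basis vectors can be nonzero
  only if its last two factors are some \<open>u r\<close>, which is where the map \<open>a\<close> is supported: \<open>a\<close>,
  and with it \<open>mu\<close> on plain symbols, records every nonzero product (\<open>nonzero_product_index\<close>).

  If \<open>T\<close> is minimal, consider the set of all indices to which a given index is connected. It is
  closed under \<open>mu\<close> with plain symbols, so its vectors span an ideal with an inherited basis
  (\<open>span_mu_closed_ideal\<close>). Starting from an element of \<open>J\<close>, this ideal contains a nonzero
  element of \<open>negI\<close>, so minimality makes it all of \<open>T\<close> and every index is reached. The set
  \<open>I\<close> is itself closed, because \<open>frakI\<close> is an ideal; so, starting from an element of \<open>I\<close>, the
  reachable indices inside \<open>I\<close> span a nonzero ideal contained in \<open>frakI\<close>, and minimality makes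
  it \<open>frakI\<close>.

  Conversely, an ideal is stable along connections: steps along plain symbols are products with
  the current basis vector, and steps along barred symbols, which lead from a product back to
  one of its factors, are turned into products by \<open>mu\<close>-multiplicativity (\<open>ideal_connected\<close>).
  So, when all elements of \<open>I\<close> are connected and all elements of \<open>J\<close> are connected, an ideal
  that contains one \<open>e n\<close> contains \<open>frakI\<close>, and one that contains one \<open>u r\<close> contains \<open>negI\<close>.
  In the latter case it contains every product, since only the component of the middle factor
  in \<open>negI\<close> matters; hence it contains the generators of \<open>frakI\<close>, thus \<open>frakI\<close>, and is all of
  \<open>T\<close> (\<open>ideal_negI_UNIV\<close>). A nonzero ideal with an inherited basis that contains no \<open>u r\<close> has
  a basis of vectors \<open>e n\<close> only, so it is \<open>frakI\<close>.
\<close>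

section \<open>Products and ideals in a Leibniz triple system\<close>

context leibniz_triple_system
begin

lemma tri_module_hom:
  "module_hom scale scale (\<lambda>x. tri x y z)"
  "module_hom scale scale (\<lambda>y. tri x y z)"
  "module_hom scale scale (\<lambda>z. tri x y z)"
  using linear1 linear2 linear3 by (simp_all add: linear_iff_module_hom)

lemma tri_add:
  "tri (x + x') y z = tri x y z + tri x' y z"
  "tri x (y + y') z = tri x y z + tri x y' z"
  "tri x y (z + z') = tri x y z + tri x y z'"
  by (rule module_hom.add[OF tri_module_hom(1)], rule module_hom.add[OF tri_module_hom(2)],
      rule module_hom.add[OF tri_module_hom(3)])

lemma tri_diff:
  "tri (x - x') y z = tri x y z - tri x' y z"
  "tri x (y - y') z = tri x y z - tri x y' z"
  "tri x y (z - z') = tri x y z - tri x y z'"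
  by (rule module_hom.diff[OF tri_module_hom(1)], rule module_hom.diff[OF tri_module_hom(2)],
      rule module_hom.diff[OF tri_module_hom(3)])

lemma tri_scale:
  "tri (scale c x) y z = scale c (tri x y z)"
  "tri x (scale c y) z = scale c (tri x y z)"
  "tri x y (scale c z) = scale c (tri x y z)"
  by (rule module_hom.scale[OF tri_module_hom(1)], rule module_hom.scale[OF tri_module_hom(2)],
      rule module_hom.scale[OF tri_module_hom(3)])

lemma tri_zero: "tri 0 y z = 0" "tri x 0 z = 0" "tri x y 0 = 0"
  using tri_scale[where c = 0] by auto

lemma ideal_frakI: "ideal frakI"
  unfolding frakI_def ideal_generated_def
  by (auto simp: ideal_def intro!: subspace_Inter)

lemma frakI_least:
  assumes "ideal S" and "\<And>x y z. tri x y z - tri x z y + tri y z x \<in> S"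
  shows "frakI \<subseteq> S"
  using assms unfolding frakI_def ideal_generated_def by blast

text \<open>
  Expanding a product that has a generator of \<open>frakI\<close> in its second or third slot by the
  matching Leibniz identity gives twelve left-normed products that cancel in pairs. Elements
  that annihilate from both of these slots form an ideal, again by the identities, so the
  property passes from the generators to \<open>frakI\<close>.
\<close>

lemma tri_frakI_right_slots:
  assumes "x \<in> frakI"
  shows "tri p x q = 0" and "tri p q x = 0"
proof -
  let ?Z = "{x. \<forall>p q. tri p x q = 0 \<and> tri p q x = 0}"
  have "ideal ?Z"
    unfolding ideal_def subspace_def
    by (auto simp: tri_zero tri_add tri_scale leibniz_mid leibniz_right)
  moreover have "tri x y z - tri x z y + tri y z x \<in> ?Z" for x y z
    by (auto simp: tri_add tri_diff leibniz_mid leibniz_right)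
  ultimately have "frakI \<subseteq> ?Z"
    by (rule frakI_least)
  with assms show "tri p x q = 0" "tri p q x = 0"
    by auto
qed

lemma subspace_tri_preimages:
  assumes "subspace S"
  shows "subspace {x. tri x y z \<in> S}" "subspace {y. tri x y z \<in> S}" "subspace {z. tri x y z \<in> S}"
  using assms by (auto simp: subspace_def tri_zero tri_add tri_scale)

lemma ideal_spanI:
  assumes span: "span A = UNIV"
    and 1: "\<And>g y z. g \<in> G \<Longrightarrow> y \<in> A \<Longrightarrow> z \<in> A \<Longrightarrow> tri g y z \<in> span G"
    and 2: "\<And>g y z. g \<in> G \<Longrightarrow> y \<in> A \<Longrightarrow> z \<in> A \<Longrightarrow> tri y g z \<in> span G"
    and 3: "\<And>g y z. g \<in> G \<Longrightarrow> y \<in> A \<Longrightarrow> z \<in> A \<Longrightarrow> tri y z g \<in> span G"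
  shows "ideal (span G)"
proof -
  note sub = subspace_tri_preimages[OF subspace_span[of G]]
  have trilinear: "tri x y z \<in> span G"
    if gens: "\<And>x y z. x \<in> X \<Longrightarrow> y \<in> Y \<Longrightarrow> z \<in> Z \<Longrightarrow> tri x y z \<in> span G"
      and mem: "x \<in> span X" "y \<in> span Y" "z \<in> span Z"
    for X Y Z x y z
  proof -
    have a: "tri x y z \<in> span G" if "y \<in> Y" "z \<in> Z" for y z
      using span_minimal[OF _ sub(1), of X y z] gens that mem(1) by blast
    have b: "tri x y z \<in> span G" if "z \<in> Z" for z
      using span_minimal[OF _ sub(2), of Y x z] a that mem(2) by blast
    show ?thesis
      using span_minimal[OF _ sub(3), of Z x y] b mem(3) by blast
  qed
  show ?thesis
    unfolding ideal_def
    using trilinear[of G A A, OF 1] trilinear[of A G A, OF 2] trilinear[of A A G, OF 3] span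
    by auto
qed

lemma subspace_nonzero_in_line:
  assumes "subspace S" and "x \<in> S" and "nonzero_in_line x w"
  shows "w \<in> S"
proof -
  from assms(3) obtain c where c: "x = scale c w" "x \<noteq> 0"
    by (auto simp: nonzero_in_line_def span_singleton)
  then have "w = scale (inverse c) x"
    by auto
  with assms(1,2) show ?thesis
    by (simp add: subspace_scale)
qed

end

section \<open>Indices of nonzero products\<close>

context leibniz_triple_split_basis
begin

lemma v_I: "k \<in> I \<Longrightarrow> v k = e k"
  by (simp add: v_def)

lemma v_J: "k \<in> J \<Longrightarrow> v k = u k"
  using IJ_disjoint by (auto simp: v_def)

lemma B_eq: "B = v ` (I \<union> J)"
  unfolding B_def image_Un using v_I v_J by (metis image_cong)

lemma e_in_frakI: "k \<in> I \<Longrightarrow> e k \<in> frakI"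
  using e_basis span_base by (auto simp: basis_of_def)

lemma u_in_negI: "k \<in> J \<Longrightarrow> u k \<in> negI"
  using u_basis span_base by (auto simp: basis_of_def)

lemma e_nonzero: "k \<in> I \<Longrightarrow> e k \<noteq> 0"
  using e_basis dependent_zero by (auto simp: basis_of_def)

lemma u_nonzero: "k \<in> J \<Longrightarrow> u k \<noteq> 0"
  using u_basis dependent_zero by (auto simp: basis_of_def)

lemma u_notin_frakI: "k \<in> J \<Longrightarrow> u k \<notin> frakI"
  using u_nonzero u_in_negI frakI_Int_negI by auto

lemma inj_v: "inj_on v (I \<union> J)"
proof (rule inj_onI)
  fix k l assume kl: "k \<in> I \<union> J" "l \<in> I \<union> J" "v k = v l"
  have "k \<in> I \<longleftrightarrow> l \<in> I"
    using kl u_notin_frakI e_in_frakI by (metis UnE v_I v_J)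
  with kl show "k = l"
    using e_inj u_inj by (auto simp: v_I v_J dest: inj_onD)
qed

lemma a_sound:
  assumes "k \<in> a p q r"
  shows "k \<in> I \<union> J" and "nonzero_in_line (tri (v p) (v q) (v r)) (v k)"
  using assms by (auto simp: a_def v_I v_J split: if_splits)

lemma a_index_in_I: "k \<in> a p q r \<Longrightarrow> p \<in> I \<or> q \<in> I \<or> r \<in> I \<Longrightarrow> k \<in> I"
  using IJ_disjoint by (auto simp: a_def split: if_splits)

text \<open>
  The products on which \<open>a\<close> is empty by definition are those with a factor \<open>e n\<close> in the second
  or third slot, and these vanish. For \<open>e n\<close> in the first slot the product lies in the ideal
  \<open>frakI\<close>, so its line cannot be spanned by some \<open>u s\<close>; hence \<open>a\<close> may search \<open>I\<close> only.
\<close>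

lemma nonzero_product_index:
  assumes mult: "multiplicative_basis UNIV B"
    and idx: "p \<in> I \<union> J" "q \<in> I \<union> J" "r \<in> I \<union> J"
    and nz: "tri (v p) (v q) (v r) \<noteq> 0"
  obtains k where "k \<in> a p q r"
proof -
  have qr: "q \<in> J" "r \<in> J"
    using idx nz tri_frakI_right_slots[OF e_in_frakI] by (auto simp: v_I)
  obtain k where k: "k \<in> I \<union> J" "nonzero_in_line (tri (v p) (v q) (v r)) (v k)"
    using mult idx nz unfolding multiplicative_basis_def B_eq by blast
  have "k \<in> I" if "p \<in> I"
  proof (rule ccontr)
    assume "k \<notin> I"
    with k(1) have "k \<in> J" by simp
    have "tri (v p) (v q) (v r) \<in> frakI"
      using ideal_frakI e_in_frakI[OF that] that by (simp add: ideal_def v_I)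
    then have "v k \<in> frakI"
      using ideal_frakI k(2) subspace_nonzero_in_line by (auto simp: ideal_def)
    with \<open>k \<in> J\<close> show False
      using u_notin_frakI by (simp add: v_J)
  qed
  with idx(1) qr k have "k \<in> a p q r"
    using IJ_disjoint by (auto simp: a_def v_I v_J)
  then show thesis by (rule that)
qed

lemma a_subset_mu:
  "a k p q \<subseteq> mu k (Plain p) (Plain q)"
  "a p k q \<subseteq> mu k (Plain p) (Plain q)"
  "a p q k \<subseteq> mu k (Plain p) (Plain q)"
proof -
  let ?s = "transpose (0::nat) 1" and ?t = "transpose (1::nat) 2"
  have s: "?s permutes {..<3}" and t: "?t permutes {..<3}"
    by (auto intro!: permutes_swap_id)
  \<comment> \<open>The cyclic permutation \<open>0 \<mapsto> 1 \<mapsto> 2 \<mapsto> 0\<close> moves \<open>k\<close> to the last slot and keeps the order of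
    \<open>p\<close> and \<open>q\<close>.\<close>
  have "?s \<circ> ?t permutes {..<3}"
    by (rule permutes_compose[OF t s])
  from UN_upper[of "?s \<circ> ?t" "{\<sigma>. \<sigma> permutes {..<3::nat}}"
      "\<lambda>\<sigma>. a ([k, p, q] ! \<sigma> 0) ([k, p, q] ! \<sigma> 1) ([k, p, q] ! \<sigma> 2)"] this
  show "a p q k \<subseteq> mu k (Plain p) (Plain q)"
    by (simp add: transpose_def)
  from UN_upper[of ?s "{\<sigma>. \<sigma> permutes {..<3::nat}}"
      "\<lambda>\<sigma>. a ([k, p, q] ! \<sigma> 0) ([k, p, q] ! \<sigma> 1) ([k, p, q] ! \<sigma> 2)"] s
  show "a p k q \<subseteq> mu k (Plain p) (Plain q)"
    by (simp add: transpose_def)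
  from UN_upper[of id "{\<sigma>. \<sigma> permutes {..<3::nat}}"
      "\<lambda>\<sigma>. a ([k, p, q] ! \<sigma> 0) ([k, p, q] ! \<sigma> 1) ([k, p, q] ! \<sigma> 2)"]
  show "a k p q \<subseteq> mu k (Plain p) (Plain q)"
    by (simp add: permutes_id)
qed

lemma mu_Plain_cases:
  assumes "l \<in> mu k (Plain p) (Plain q)"
  obtains k1 k2 k3 where "l \<in> a k1 k2 k3" "k \<in> {k1, k2, k3}"
proof -
  from assms obtain \<sigma> where \<sigma>: "\<sigma> permutes {..<3::nat}"
    and l: "l \<in> a ([k, p, q] ! \<sigma> 0) ([k, p, q] ! \<sigma> 1) ([k, p, q] ! \<sigma> 2)"
    by auto
  have "(0::nat) \<in> \<sigma> ` {..<3}"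
    using permutes_image[OF \<sigma>] by simp
  then obtain j where j: "j < 3" "\<sigma> j = 0"
    by auto
  then have "j = 0 \<or> j = 1 \<or> j = 2"
    by linarith
  with j(2) have "k \<in> {[k, p, q] ! \<sigma> 0, [k, p, q] ! \<sigma> 1, [k, p, q] ! \<sigma> 2}"
    by auto
  with l show thesis by (rule that)
qed

lemma mu_Plain_index: "l \<in> mu k (Plain p) (Plain q) \<Longrightarrow> l \<in> I \<union> J"
  by (erule mu_Plain_cases) (rule a_sound)

lemma mu_Plain_I: "k \<in> I \<Longrightarrow> l \<in> mu k (Plain p) (Plain q) \<Longrightarrow> l \<in> I"
  by (erule mu_Plain_cases) (auto dest: a_index_in_I)

lemma mu_Bar_indices:
  assumes "l \<in> mu k (Bar p) (Bar q)"
  shows "p \<in> J" and "q \<in> J" and "l \<in> I \<union> J"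
proof -
  from assms obtain \<sigma> where \<sigma>: "\<sigma> permutes {..<2::nat}"
    and l: "l \<in> b k ([p, q] ! \<sigma> 0) ([p, q] ! \<sigma> 1)"
    by auto
  have "\<sigma> ` {0, 1} = {0, 1}"
    using permutes_image[OF \<sigma>] by (simp add: lessThan_Suc numeral_2_eq_2 insert_commute)
  then have "{[p, q] ! \<sigma> 0, [p, q] ! \<sigma> 1} = {p, q}"
    by (auto simp: doubleton_eq_iff)
  moreover have "[p, q] ! \<sigma> 0 \<in> J" "[p, q] ! \<sigma> 1 \<in> J" "l \<in> I \<union> J"
    using l by (auto simp: b_def split: if_splits)
  ultimately have "{p, q} \<subseteq> J" "l \<in> I \<union> J"
    by (metis empty_subsetI insert_subset, metis)
  then show "p \<in> J" and "q \<in> J" and "l \<in> I \<union> J"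
    by simp_all
qed

section \<open>Connections\<close>

lemma connected_to_refl: "k \<in> I \<union> J \<Longrightarrow> connected_to k k"
  by (simp add: connected_to_def)

lemma phi_iter_append:
  "2 * i < length ks \<Longrightarrow> phi_iter k (ks @ ls) i = phi_iter k ks i"
  by (induction i) (auto simp: nth_append)

text \<open>
  All intermediate sets of the prolonged connection are nonempty: the new one contains the
  old endpoint.
\<close>

lemma connected_to_mu:
  assumes con: "connected_to k l" and l': "l' \<in> mu l (Plain p) (Plain q)"
    and pq: "p \<in> I \<union> J" "q \<in> I \<union> J"
  shows "connected_to k l'"
proof -
  have idx: "k \<in> I \<union> J" "l' \<in> I \<union> J"
    using con mu_Plain_index[OF l'] by (simp_all add: connected_to_def)
  have "\<exists>ks. connection k l' ks"
  proof (cases "k = l")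
    case True
    have "connection k l' [Plain k, Plain p, Plain q]"
      unfolding connection_def using idx pq l' True
      by (intro conjI exI[of _ 1]) (auto simp: symbols_def phi_def simp del: mu.simps)
    then show ?thesis ..
  next
    case False
    with con obtain ks n where ks: "set ks \<subseteq> symbols" "n \<ge> 1" "length ks = 2 * n + 1"
      "ks ! 0 = Plain k" "\<forall>i\<in>{1..<n}. phi_iter k ks i \<noteq> {}" "l \<in> phi_iter k ks n"
      by (auto simp: connected_to_def connection_def)
    let ?ks = "ks @ [Plain p, Plain q]"
    have old: "phi_iter k ?ks i = phi_iter k ks i" if "i \<le> n" for i
      using that ks(3) by (intro phi_iter_append) simp
    have "phi_iter k ?ks i \<noteq> {}" if "i \<in> {1..<Suc n}" for i
      using that old[of i] ks(5,6) by (cases "i = n") auto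
    moreover have "l' \<in> phi_iter k ?ks (Suc n)"
      using old[of n] ks(3,6) l' by (auto simp: phi_def nth_append simp del: mu.simps)
    moreover have "set ?ks \<subseteq> symbols" "length ?ks = 2 * Suc n + 1" "?ks ! 0 = Plain k"
      using ks pq by (auto simp: symbols_def nth_append)
    ultimately have "connection k l' ?ks"
      unfolding connection_def by (intro conjI exI[of _ "Suc n"]) auto
    then show ?thesis ..
  qed
  with idx show ?thesis
    by (auto simp: connected_to_def)
qed

text \<open>
  A barred step leads from the value of a product to one of its factors, and an ideal need not
  contain the factors of its elements; \<open>mu\<close>-multiplicativity supplies a product that has the
  current vector as a factor and the new one as its value, up to scalars.
\<close>

lemma ideal_connected:
  assumes S: "ideal S" and mm: "mu_multiplicative"
    and con: "connected_to k k'" and k: "v k \<in> S"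
  shows "v k' \<in> S"
proof -
  have sub: "subspace S"
    using S by (simp add: ideal_def)
  have step: "l' \<in> I \<union> J \<and> v l' \<in> S"
    if l': "l' \<in> mu l p q" and l: "l \<in> I \<union> J" "v l \<in> S" for l l' p q
  proof (cases p; cases q)
    fix r s assume pq: "p = Plain r" "q = Plain s"
    with l' obtain k1 k2 k3 where a: "l' \<in> a k1 k2 k3" "l \<in> {k1, k2, k3}"
      by (auto elim: mu_Plain_cases simp del: mu.simps)
    have "tri (v k1) (v k2) (v k3) \<in> S"
      using S l(2) a(2) by (auto simp: ideal_def)
    then show ?thesis
      using a_sound[OF a(1)] subspace_nonzero_in_line[OF sub] by blast
  next
    fix r s assume pq: "p = Bar r" "q = Bar s"
    have rs: "r \<in> J" "s \<in> J" "l' \<in> I \<union> J"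
      using mu_Bar_indices l' pq by auto
    with mm l' l pq obtain \<sigma> where
      "v l' \<in> span {tri (v l) (u ([r, s] ! \<sigma> 0)) (u ([r, s] ! \<sigma> (1::nat)))}"
      unfolding mu_multiplicative_def by blast
    moreover have "tri (v l) (u ([r, s] ! \<sigma> 0)) (u ([r, s] ! \<sigma> 1)) \<in> S"
      using S l(2) by (auto simp: ideal_def)
    ultimately show ?thesis
      using rs(3) span_minimal[OF _ sub] by blast
  qed (use l' in auto)
  have "\<forall>l\<in>phi_iter k ks i. l \<in> I \<union> J \<and> v l \<in> S" for ks i
  proof (induction i)
    case 0
    with con k show ?case by (auto simp: connected_to_def)
  next
    case (Suc i)
    then show ?case by (auto simp: phi_def dest: step simp del: mu.simps)
  qed
  with con k show ?thesis
    by (auto simp: connected_to_def connection_def)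
qed

section \<open>Ideals spanned by basis vectors\<close>

lemma span_v_index:
  assumes mult: "multiplicative_basis UNIV B"
    and "C \<subseteq> I \<union> J" "k \<in> I \<union> J" "v k \<in> span (v ` C)"
  shows "k \<in> C"
proof (rule ccontr)
  assume "k \<notin> C"
  with assms have "v k \<notin> v ` C"
    using inj_v by (auto dest: inj_onD)
  with assms(2) have "v ` C \<subseteq> B - {v k}"
    unfolding B_eq by blast
  with assms have "v k \<in> span (B - {v k})"
    using span_mono by blast
  with assms show False
    by (auto simp: B_eq multiplicative_basis_def basis_of_def dependent_def)
qed

text \<open>
  Only plain symbols occur because only they stand for products, and an ideal is closed under
  products.
\<close>

definition mu_closed :: "'k set \<Rightarrow> bool" where
  "mu_closed C \<longleftrightarrow> C \<subseteq> I \<union> J \<and>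
     (\<forall>k\<in>C. \<forall>p\<in>I \<union> J. \<forall>q\<in>I \<union> J. mu k (Plain p) (Plain q) \<subseteq> C)"

lemma mu_closed_I: "mu_closed I"
  unfolding mu_closed_def using mu_Plain_I by blast

lemma mu_closed_Int: "mu_closed C \<Longrightarrow> mu_closed D \<Longrightarrow> mu_closed (C \<inter> D)"
  unfolding mu_closed_def by blast

lemma mu_closed_connected: "mu_closed {l. connected_to k l}"
proof -
  have "{l. connected_to k l} \<subseteq> I \<union> J"
    unfolding connected_to_def by blast
  then show ?thesis
    unfolding mu_closed_def using connected_to_mu by blast
qed

text \<open>
  A nonzero product with a factor from the closed set, in whichever slot, has its index in
  that set. This gives the ideal property, and also shows that the lines of the products of
  the spanning vectors are lines of spanning vectors, so the basis is inherited.
\<close>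

lemma span_mu_closed_ideal:
  assumes mult: "multiplicative_basis UNIV B" and C: "mu_closed C"
  shows "ideal (span (v ` C))" and "admits_inherited_basis B (span (v ` C))"
proof -
  have CIJ: "C \<subseteq> I \<union> J"
    using C by (simp add: mu_closed_def)
  have line: "\<exists>l\<in>C. nonzero_in_line (tri (v k1) (v k2) (v k3)) (v l)"
    if nz: "tri (v k1) (v k2) (v k3) \<noteq> 0" and idx: "k1 \<in> I \<union> J" "k2 \<in> I \<union> J" "k3 \<in> I \<union> J"
      and hit: "k1 \<in> C \<or> k2 \<in> C \<or> k3 \<in> C" for k1 k2 k3
  proof -
    obtain l where l: "l \<in> a k1 k2 k3"
      using nonzero_product_index[OF mult idx nz] .
    with hit idx C have "l \<in> C"
      using a_subset_mu[of k1 k2 k3] a_subset_mu[of k2 k1 k3] a_subset_mu[of k3 k1 k2]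
      unfolding mu_closed_def by blast
    with a_sound(2)[OF l] show ?thesis by blast
  qed
  have in_span: "tri (v k1) (v k2) (v k3) \<in> span (v ` C)"
    if idx: "k1 \<in> I \<union> J" "k2 \<in> I \<union> J" "k3 \<in> I \<union> J" "k1 \<in> C \<or> k2 \<in> C \<or> k3 \<in> C"
    for k1 k2 k3
  proof (cases "tri (v k1) (v k2) (v k3) = 0")
    case True
    then show ?thesis by (simp add: span_zero)
  next
    case False
    then obtain l where "l \<in> C" "tri (v k1) (v k2) (v k3) \<in> span {v l}"
      using line[OF False idx] unfolding nonzero_in_line_def by blast
    then show ?thesis
      using span_mono[of "{v l}" "v ` C"] by auto
  qed
  have "span B = UNIV"
    using mult by (simp add: multiplicative_basis_def basis_of_def)
  then show ideal: "ideal (span (v ` C))"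
    by (rule ideal_spanI) (use in_span CIJ in \<open>auto simp: B_eq\<close>)
  then have "subtriple (span (v ` C))"
    by (auto simp: ideal_def subtriple_def)
  moreover have "v ` C \<subseteq> B"
    using CIJ by (auto simp: B_eq)
  moreover have "independent (v ` C)"
    using mult \<open>v ` C \<subseteq> B\<close> independent_mono
    by (auto simp: multiplicative_basis_def basis_of_def)
  moreover have "\<forall>x\<in>v ` C. \<forall>y\<in>v ` C. \<forall>z\<in>v ` C.
      tri x y z = 0 \<or> (\<exists>w\<in>v ` C. nonzero_in_line (tri x y z) w)"
    using line CIJ by blast
  ultimately show "admits_inherited_basis B (span (v ` C))"
    unfolding admits_inherited_basis_def multiplicative_basis_def basis_of_def by blast
qed

text \<open>
  Split the middle factor of a product along \<open>frakI \<oplus> negI\<close>: the part in \<open>frakI\<close> contributes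
  zero and the part in \<open>negI\<close> contributes an element of the ideal. So the ideal contains all
  products, in particular the generators of \<open>frakI\<close>.
\<close>

lemma ideal_negI_UNIV:
  assumes S: "ideal S" and neg: "negI \<subseteq> S"
  shows "S = UNIV"
proof -
  have sub: "subspace S"
    using S by (simp add: ideal_def)
  have decomp: "\<exists>x' y'. x = x' + y' \<and> x' \<in> frakI \<and> y' \<in> S" for x
    using frakI_plus_negI neg by blast
  have prod: "tri x y z \<in> S" for x y z
  proof -
    obtain y1 y2 where y: "y = y1 + y2" "y1 \<in> frakI" "y2 \<in> S"
      using decomp by blast
    have "tri x y z = tri x y1 z + tri x y2 z"
      by (simp add: y tri_add)
    also have "\<dots> = tri x y2 z"
      using tri_frakI_right_slots y by simp
    also have "\<dots> \<in> S"
      using S y by (simp add: ideal_def)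
    finally show ?thesis .
  qed
  have "frakI \<subseteq> S"
    using S prod by (intro frakI_least) (auto intro!: subspace_add subspace_diff sub)
  then have "x \<in> S" for x
    using decomp[of x] by (auto intro: subspace_add[OF sub])
  then show ?thesis
    by blast
qed

section \<open>Minimality and connectedness\<close>

text \<open>
  Barred steps can lead from \<open>I\<close> to \<open>J\<close>. Intersecting the reachable set with \<open>I\<close> keeps the ideal
  inside \<open>frakI\<close>, so that it equals \<open>frakI\<close> whichever alternative of minimality holds.
\<close>

lemma minimal_imp_connected_I:
  assumes mult: "multiplicative_basis UNIV B" and min: "minimal B"
    and n: "n \<in> I" "n' \<in> I"
  shows "connected_to n n'"
proof -
  let ?C = "{l. connected_to n l} \<inter> I"
  let ?S = "span (v ` ?C)"
  have C: "mu_closed ?C"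
    by (intro mu_closed_Int mu_closed_connected mu_closed_I)
  have "n \<in> ?C"
    using n by (simp add: connected_to_refl)
  then have "v n \<in> ?S"
    by (rule span_base[OF imageI])
  with n have "?S \<noteq> {0}"
    using e_nonzero by (auto simp: v_I)
  then have "?S = frakI \<or> ?S = UNIV"
    using min[unfolded minimal_def, rule_format, of ?S] span_mu_closed_ideal[OF mult C] by argo
  then have "v n' \<in> ?S"
    using n e_in_frakI by (auto simp: v_I)
  with n have "n' \<in> ?C"
    by (intro span_v_index[OF mult, of ?C]) auto
  then show ?thesis by simp
qed

text \<open>
  The ideal contains \<open>u r\<close>, which lies outside \<open>frakI\<close>; so minimality leaves only the whole space,
  and the elements of \<open>I\<close> are reached as well.
\<close>

lemma minimal_imp_connected_J:
  assumes mult: "multiplicative_basis UNIV B" and min: "minimal B"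
    and r: "r \<in> J" and k: "k \<in> I \<union> J"
  shows "connected_to r k"
proof -
  let ?C = "{l. connected_to r l}"
  let ?S = "span (v ` ?C)"
  have C: "mu_closed ?C"
    by (rule mu_closed_connected)
  have "r \<in> ?C"
    using r by (simp add: connected_to_refl)
  then have "v r \<in> ?S"
    by (rule span_base[OF imageI])
  moreover have "v r \<noteq> 0" "v r \<notin> frakI"
    using r u_nonzero u_notin_frakI by (simp_all add: v_J)
  ultimately have "?S \<noteq> {0}" "?S \<noteq> frakI"
    by (metis singletonD, metis)
  then have "?S = UNIV"
    using min[unfolded minimal_def, rule_format, of ?S] span_mu_closed_ideal[OF mult C] by argo
  then have "v k \<in> ?S"
    by simp
  moreover have "?C \<subseteq> I \<union> J"
    using C by (simp add: mu_closed_def)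
  ultimately have "k \<in> ?C"
    using k by (intro span_v_index[OF mult, of ?C])
  then show ?thesis by simp
qed

lemma connected_imp_minimal:
  assumes mm: "mu_multiplicative"
    and conI: "\<forall>n\<in>I. \<forall>n'\<in>I. connected_to n n'"
    and conJ: "\<forall>r\<in>J. \<forall>r'\<in>J. connected_to r r'"
  shows "minimal B"
  unfolding minimal_def
proof (intro allI impI, elim conjE)
  fix S assume S: "ideal S" "S \<noteq> {0}" "admits_inherited_basis B S"
  have sub: "subspace S"
    using S by (simp add: ideal_def)
  obtain B' where B': "B' \<subseteq> B" "span B' = S"
    using S(3) by (auto simp: admits_inherited_basis_def multiplicative_basis_def basis_of_def)
  then have B'S: "B' \<subseteq> S"
    using span_superset by blast
  show "S = frakI \<or> S = UNIV"
  proof (cases "\<exists>r\<in>J. u r \<in> S")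
    case True
    then obtain r where r: "r \<in> J" "v r \<in> S"
      by (auto simp: v_J)
    then have "v r' \<in> S" if "r' \<in> J" for r'
      using conJ ideal_connected[OF S(1) mm] that by blast
    then have "u ` J \<subseteq> S"
      by (auto simp: v_J)
    then have "negI \<subseteq> S"
      using span_minimal[OF _ sub, of "u ` J"] u_basis by (simp add: basis_of_def)
    then show ?thesis
      using ideal_negI_UNIV[OF S(1)] by simp
  next
    case False
    then have B'I: "B' \<subseteq> e ` I"
      using B'(1) B'S unfolding B_def by blast
    have "B' \<noteq> {}"
      using B' S(2) by auto
    with B'I obtain n where "n \<in> I" "e n \<in> B'"
      by blast
    then have n: "n \<in> I" "v n \<in> S"
      using B'S by (auto simp: v_I)
    then have "v n' \<in> S" if "n' \<in> I" for n'
      using conI ideal_connected[OF S(1) mm] that by blast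
    then have "e ` I \<subseteq> S"
      by (auto simp: v_I)
    then have "frakI \<subseteq> S"
      using span_minimal[OF _ sub, of "e ` I"] e_basis by (simp add: basis_of_def)
    moreover have "S \<subseteq> frakI"
      using B' span_mono[OF B'I] e_basis by (simp add: basis_of_def)
    ultimately show ?thesis by simp
  qed
qed

end

theorem theorem3p1:
  fixes scale :: "'f::field \<Rightarrow> 'v::ab_group_add \<Rightarrow> 'v"
    and tri :: "'v \<Rightarrow> 'v \<Rightarrow> 'v \<Rightarrow> 'v"
    and negI :: "'v set" and I J :: "'k set" and e u :: "'k \<Rightarrow> 'v"
  assumes "leibniz_triple_split_basis scale tri negI I J e u"
    and "leibniz_triple_split_basis.mu_multiplicative scale tri I J e u"
  shows "leibniz_triple_system.minimal scale tri (leibniz_triple_split_basis.B I J e u) \<longleftrightarrow>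
    (\<forall>n\<in>I. \<forall>n'\<in>I. leibniz_triple_split_basis.connected_to scale tri I J e u n n') \<and>
    (\<forall>r\<in>J. \<forall>r'\<in>J. leibniz_triple_split_basis.connected_to scale tri I J e u r r')"
proof -
  interpret leibniz_triple_split_basis scale tri negI I J e u
    by (rule assms(1))
  have mult: "multiplicative_basis UNIV B"
    using assms(2) by (simp add: mu_multiplicative_def)
  show ?thesis
    using minimal_imp_connected_I[OF mult] minimal_imp_connected_J[OF mult]
      connected_imp_minimal[OF assms(2)] by blast
qed

end
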